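(* Let $A\in\mathbb{R}^{n\times n}$, and let $\mathcal{C}\subseteq\mathbb{R}^n$ be a proper cone. Assume that $\mathcal{C}$ is an invariant set for the continuous system $\dot{x}(t)=Ax(t)$. Then there exists $\hat\tau>0$ such that for every $x_k\in\mathcal{C}$ and every $\Delta t\in[0,\hat\tau]$, we have $x_{k+1}\in\mathcal{C}$, where $x_{k+1}=(I-\Delta t A)^{-1}x_k$ is obtained by the backward Euler method; i.e., $\mathcal{C}$ is an invariant set for the discrete system $x_{k+1}=(I-\Delta t A)^{-1}x_k$ for every such $\Delta t$.
   Context: A convex cone $\mathcal{C}$ is called proper if it is nonempty, closed, and pointed (pointed: $\mathcal{C}\cap(-\mathcal{C})=\{0\}$). A set $\mathcal{S}$ is an invariant set for $\dot x(t)=Ax(t)$ if $x(0)\in\mathcal{S}$ implies $x(t)\in\mathcal{S}$ for all $t\ge0$. It is an invariant set for a discrete system $x_{k+1}=Mx_k$ if $x_k\in\mathcal{S}$ implies $x_{k+1}\in\mathcal{S}$ for all $k\in\mathbb{N}$. A statement about $x_{k+1}=(I-\Delta t A)^{-1}x_k$ is understood to include that $I-\Delta t A$ is nonsingular. *)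

theory Defs
  imports "HOL-Analysis.Analysis"
begin

definition proper_cone :: "'a::real_normed_vector set \<Rightarrow> bool" where
  "proper_cone C \<longleftrightarrow> convex_cone C \<and> C \<noteq> {} \<and> closed C \<and> C \<inter> uminus ` C = {0}"

text \<open>Solutions live on \<open>t \<ge> 0\<close>; the derivative at \<open>t = 0\<close> is one-sided.\<close>

definition continuous_solution :: "real^'n^'n \<Rightarrow> (real \<Rightarrow> real^'n) \<Rightarrow> bool" where
  "continuous_solution A x \<longleftrightarrow>
     (\<forall>t\<ge>0. (x has_vector_derivative A *v x t) (at t within {0..}))"

definition continuous_invariant :: "real^'n^'n \<Rightarrow> (real^'n) set \<Rightarrow> bool" where
  "continuous_invariant A S \<longleftrightarrow>
     (\<forall>x. continuous_solution A x \<longrightarrow> x 0 \<in> S \<longrightarrow> (\<forall>t\<ge>0. x t \<in> S))"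

definition discrete_solution :: "real^'n^'n \<Rightarrow> (nat \<Rightarrow> real^'n) \<Rightarrow> bool" where
  "discrete_solution M x \<longleftrightarrow> (\<forall>k. x (Suc k) = M *v x k)"

definition discrete_invariant :: "real^'n^'n \<Rightarrow> (real^'n) set \<Rightarrow> bool" where
  "discrete_invariant M S \<longleftrightarrow>
     (\<forall>x. discrete_solution M x \<longrightarrow> (\<forall>k. x k \<in> S \<longrightarrow> x (Suc k) \<in> S))"

end

theory Submission
  imports Defs
begin

text \<open>
  The idea is to replace invariance under the flow by an infinitesimal condition and then to
  refute any violation of it by the nearest-point projection.

  If \<open>C\<close> is invariant, \<open>c \<in> C\<close>, and \<open>v\<close> is nonnegative on \<open>C\<close> with \<open>v \<bullet> c = 0\<close>, then along the
  solution starting at \<open>c\<close> the quantity \<open>v \<bullet> x t\<close> starts at \<open>0\<close> and never becomes negative, so its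
  initial derivative \<open>v \<bullet> A c\<close> is nonnegative: the vector field never points out of \<open>C\<close> (lemma
  \<open>invariant_imp_subtangential\<close>). Invariance is a statement about all solutions and says
  nothing about \<open>c\<close> unless a solution through \<open>c\<close> exists; one is given by the exponential series
  (lemma \<open>continuous_solution_exists\<close>).

  Now let \<open>y - h A y = x \<in> C\<close>, let \<open>p\<close> be the point of \<open>C\<close> nearest to \<open>y\<close>, and put \<open>v = p - y\<close>.
  Since \<open>C\<close> is a cone, \<open>v\<close> is nonnegative on \<open>C\<close> and orthogonal to \<open>p\<close>. Writing \<open>y = p - v\<close> gives
  \<open>v \<bullet> x = - v \<bullet> v - h (v \<bullet> A p) + h (v \<bullet> A v)\<close>. The left side is nonnegative and the middle term
  on the right is at most \<open>0\<close>, so \<open>v \<bullet> v \<le> h (v \<bullet> A v) \<le> h K (v \<bullet> v)\<close>, where \<open>K\<close> bounds the norm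
  of \<open>A\<close>. As soon as \<open>h K < 1\<close> this forces \<open>v = 0\<close>, that is, \<open>y = p \<in> C\<close>. The same bound makes
  \<open>I - h A\<close> injective, hence invertible.
\<close>

section \<open>Existence of solutions of linear systems\<close>

lemma norm_funpow_le:
  fixes f :: "'a::real_normed_vector \<Rightarrow> 'a"
  assumes "\<And>x. norm (f x) \<le> K * norm x" "0 \<le> K"
  shows "norm ((f ^^ k) c) \<le> K ^ k * norm c"
proof (induction k)
  case (Suc k)
  have "norm ((f ^^ Suc k) c) \<le> K * norm ((f ^^ k) c)"
    using assms(1) by simp
  also have "\<dots> \<le> K * (K ^ k * norm c)"
    using Suc assms(2) by (rule mult_left_mono)
  finally show ?case by (simp add: mult.assoc)
qed simp

text \<open>
  The solution is the exponential series applied to the initial vector,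
  \<open>x t = (\<Sum>k. t ^ k / k! * f ^ k c)\<close>. Each of its coordinates is an everywhere convergent real
  power series, so that termwise differentiation is available coordinate by coordinate.
\<close>

lemma linear_ode_solution_exists:
  fixes f :: "'a::euclidean_space \<Rightarrow> 'a"
  assumes "linear f"
  obtains x where "x 0 = c" "\<And>t. (x has_vector_derivative f (x t)) (at t)"
proof -
  have bl: "bounded_linear f"
    using assms by (rule linear_conv_bounded_linear[THEN iffD1])
  obtain K where K: "0 \<le> K" "\<And>x. norm (f x) \<le> K * norm x"
    using bounded_linear.nonneg_bounded[OF bl] by (metis mult.commute)
  define a where "a k = (f ^^ k) c /\<^sub>R fact k" for k
  have f_a: "f (a k) = of_nat (Suc k) *\<^sub>R a (Suc k)" for k
  proof -
    have "inverse (fact k) = real (Suc k) * inverse (fact (Suc k))"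
      by (simp del: of_nat_Suc)
    then show ?thesis
      using bl by (simp add: a_def linear_simps del: of_nat_Suc fact_Suc)
  qed
  have summ: "summable (\<lambda>k. t ^ k *\<^sub>R a k)" for t
  proof (rule summable_comparison_test)
    show "summable (\<lambda>k. norm c * (inverse (fact k) * (K * \<bar>t\<bar>) ^ k))"
      by (intro summable_mult summable_exp)
    have "norm (t ^ k *\<^sub>R a k) \<le> norm c * (inverse (fact k) * (K * \<bar>t\<bar>) ^ k)" for k
    proof -
      have "norm (t ^ k *\<^sub>R a k) = (\<bar>t\<bar> ^ k * inverse (fact k)) * norm ((f ^^ k) c)"
        by (simp add: a_def power_abs abs_mult)
      also have "\<dots> \<le> (\<bar>t\<bar> ^ k * inverse (fact k)) * (K ^ k * norm c)"
        by (intro mult_left_mono norm_funpow_le K) auto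
      finally show ?thesis by (simp add: power_mult_distrib mult_ac)
    qed
    then show "\<exists>N. \<forall>k\<ge>N. norm (t ^ k *\<^sub>R a k) \<le> norm c * (inverse (fact k) * (K * \<bar>t\<bar>) ^ k)"
      by blast
  qed
  define x where "x t = (\<Sum>k. t ^ k *\<^sub>R a k)" for t
  have coord: "(\<lambda>k. (a k \<bullet> b) * t ^ k) sums (x t \<bullet> b)" for t b
    using bounded_linear.sums[OF bounded_linear_inner_left[of b] summable_sums[OF summ[of t]]]
    by (simp add: x_def mult.commute)
  have f_coord: "(\<lambda>k. diffs (\<lambda>k. a k \<bullet> b) k * t ^ k) sums (f (x t) \<bullet> b)" for t b
  proof -
    have "(\<lambda>k. f (t ^ k *\<^sub>R a k)) sums f (x t)"
      unfolding x_def by (intro bounded_linear.sums[OF bl] summable_sums summ)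
    then have "(\<lambda>k. f (t ^ k *\<^sub>R a k) \<bullet> b) sums (f (x t) \<bullet> b)"
      by (rule bounded_linear.sums[OF bounded_linear_inner_left])
    moreover have "f (t ^ k *\<^sub>R a k) \<bullet> b = diffs (\<lambda>k. a k \<bullet> b) k * t ^ k" for k
      by (simp add: linear_cmul[OF assms] f_a diffs_def)
    ultimately show ?thesis by simp
  qed
  have "((\<lambda>t. x t \<bullet> b) has_real_derivative f (x t) \<bullet> b) (at t)" for t b
    using termdiffs_strong_converges_everywhere[of "\<lambda>k. a k \<bullet> b" t, OF sums_summable[OF coord]]
    by (simp only: sums_unique[OF coord, symmetric] sums_unique[OF f_coord, symmetric])
  then have deriv_coord:
    "((\<lambda>t. x t \<bullet> b) has_derivative (\<lambda>s. (s *\<^sub>R f (x t)) \<bullet> b)) (at t)" for t b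
    by (rule has_field_derivative_imp_has_derivative[THEN has_derivative_eq_rhs])
       (simp add: fun_eq_iff mult.commute)
  show thesis
  proof (rule that[of x])
    show "x 0 = c"
    proof (rule euclidean_eqI)
      fix b
      have "(\<lambda>k. (a k \<bullet> b) * 0 ^ k) sums (x 0 \<bullet> b)"
        by (rule coord)
      then show "x 0 \<bullet> b = c \<bullet> b"
        by (simp only: powser_sums_zero_iff) (simp add: a_def)
    qed
    show "(x has_vector_derivative f (x t)) (at t)" for t
      unfolding has_vector_derivative_def has_derivative_componentwise_within[of x]
      using deriv_coord by blast
  qed
qed

lemma continuous_solution_exists:
  obtains x where "continuous_solution A x" "x 0 = c"
proof -
  obtain x where "x 0 = c" "\<And>t. (x has_vector_derivative A *v x t) (at t)"
    using linear_ode_solution_exists[OF matrix_vector_mul_linear[of A]] by blast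
  then show thesis
    by (intro that[of x])
       (auto simp: continuous_solution_def intro: has_vector_derivative_at_within)
qed

section \<open>The infinitesimal form of invariance\<close>

text \<open>
  If the derivative at time \<open>0\<close> of \<open>v \<bullet> x t\<close> were negative, the solution would leave the
  half-space of the vectors \<open>s\<close> with \<open>v \<bullet> s \<ge> 0\<close> immediately, although this half-space contains \<open>S\<close>.
\<close>

lemma invariant_imp_subtangential:
  assumes inv: "continuous_invariant A S"
    and c: "c \<in> S" "v \<bullet> c = 0"
    and v: "\<And>s. s \<in> S \<Longrightarrow> 0 \<le> v \<bullet> s"
  shows "0 \<le> v \<bullet> (A *v c)"
proof (rule ccontr)
  assume neg: "\<not> ?thesis"
  obtain x where x: "continuous_solution A x" "x 0 = c"
    by (rule continuous_solution_exists)
  then have "(x has_vector_derivative A *v c) (at 0 within {0..})"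
    unfolding continuous_solution_def by (metis order_refl)
  then have "((\<lambda>t. v \<bullet> x t) has_vector_derivative v \<bullet> (A *v c)) (at 0 within {0..})"
    by (rule bounded_linear.has_vector_derivative[OF bounded_linear_inner_right])
  then have "((\<lambda>t. v \<bullet> x t) has_real_derivative v \<bullet> (A *v c)) (at 0 within {0..})"
    by (simp add: has_real_derivative_iff_has_vector_derivative)
  from has_real_derivative_neg_dec_right[OF this] neg
  obtain d where d: "0 < d" "\<And>h. 0 < h \<Longrightarrow> h < d \<Longrightarrow> v \<bullet> x h < v \<bullet> x 0"
    by auto
  have "v \<bullet> x (d / 2) < 0"
    using d(2)[of "d / 2"] d(1) x(2) c(2) by simp
  moreover have "x (d / 2) \<in> S"
    using inv[unfolded continuous_invariant_def, rule_format, OF x(1)] x(2) c(1) d(1) by simp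
  ultimately show False
    using v[of "x (d / 2)"] by simp
qed

section \<open>Backward Euler steps stay in the cone\<close>

text \<open>
  Moreau's decomposition with respect to a closed convex cone: the residual of the nearest-point
  projection, taken towards the cone, lies in the dual cone and is orthogonal to the projection.
\<close>

lemma convex_cone_projection:
  fixes C :: "'a::euclidean_space set"
  assumes C: "convex_cone C" "closed C"
  obtains p where "p \<in> C" "(p - y) \<bullet> p = 0" "\<And>c. c \<in> C \<Longrightarrow> 0 \<le> (p - y) \<bullet> c"
proof -
  define p where "p = closest_point C y"
  have p: "p \<in> C"
    using C by (simp add: p_def closest_point_in_set convex_cone_nonempty)
  have obtuse: "0 \<le> (p - y) \<bullet> (c - p)" if "c \<in> C" for c
    using closest_point_dot[of C c y] that C
    by (simp add: p_def convex_cone_def inner_diff_left)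
  \<comment> \<open>Testing with the points \<open>0\<close> and \<open>2 p\<close> on the ray through \<open>p\<close> yields both inequalities.\<close>
  have "(p - y) \<bullet> p = 0"
    using obtuse[of 0] obtuse[of "2 *\<^sub>R p"] convex_cone_contains_0[OF C(1)]
      convex_cone_scaleR[OF C(1) _ p, of 2]
    by (simp add: scaleR_2)
  then show thesis
    using that[of p] p obtuse by (simp add: inner_diff_right)
qed

text \<open>
  For the residual \<open>v\<close> of the projection of \<open>y\<close>, pairing the implicit equation with \<open>v\<close> leaves only
  terms quadratic in \<open>v\<close>, because the contribution of the projection has a favourable sign; a step
  with \<open>h * K < 1\<close> then leaves no room for a nonzero residual.
\<close>

lemma implicit_step_mem_cone:
  fixes A :: "real^'n^'n"
  assumes C: "convex_cone C" "closed C"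
    and inv: "continuous_invariant A C"
    and K: "\<And>x. norm (A *v x) \<le> K * norm x"
    and h: "0 \<le> h" "h * K < 1"
    and y: "y - h *\<^sub>R (A *v y) \<in> C"
  shows "y \<in> C"
proof -
  obtain p where p: "p \<in> C" "(p - y) \<bullet> p = 0" and dual: "\<And>c. c \<in> C \<Longrightarrow> 0 \<le> (p - y) \<bullet> c"
    using convex_cone_projection[OF C, of y] by blast
  define v where "v = p - y"
  have y_eq: "y = p - v"
    by (simp add: v_def)
  have "0 \<le> v \<bullet> (A *v p)"
    unfolding v_def by (rule invariant_imp_subtangential[OF inv p dual])
  then have "0 \<le> h * (v \<bullet> (A *v p))"
    using h(1) by simp
  moreover have "0 \<le> v \<bullet> (y - h *\<^sub>R (A *v y))"
    unfolding v_def by (rule dual[OF y])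
  moreover have "v \<bullet> p = 0"
    using p(2) by (simp add: v_def)
  ultimately have "v \<bullet> v \<le> h * (v \<bullet> (A *v v))"
    by (simp add: y_eq matrix_vector_mult_diff_distrib inner_diff_right right_diff_distrib)
  also have "v \<bullet> (A *v v) \<le> norm v * (K * norm v)"
    using norm_cauchy_schwarz[of v "A *v v"] mult_left_mono[OF K[of v] norm_ge_zero[of v]]
    by linarith
  then have "h * (v \<bullet> (A *v v)) \<le> h * (norm v * (K * norm v))"
    using h(1) by (rule mult_left_mono)
  also have "\<dots> = (h * K) * (v \<bullet> v)"
    by (simp add: dot_square_norm power2_eq_square)
  finally have "(1 - h * K) * (v \<bullet> v) \<le> 0"
    by (simp add: algebra_simps)
  with h(2) have "v = 0"
    by (simp add: mult_le_0_iff dot_square_norm)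
  with p(1) show ?thesis
    by (simp add: y_eq)
qed

lemma identity_minus_contraction_invertible:
  fixes A :: "real^'n^'n"
  assumes K: "\<And>x. norm (A *v x) \<le> K * norm x"
    and h: "0 \<le> h" "h * K < 1"
  shows "invertible (mat 1 - h *\<^sub>R A)"
proof -
  have "x = 0" if "(mat 1 - h *\<^sub>R A) *v x = 0" for x
  proof -
    have "x = h *\<^sub>R (A *v x)"
      using that by (simp add: matrix_vector_mult_diff_rdistrib scaleR_matrix_vector_assoc)
    then have "norm x = h * norm (A *v x)"
      using h(1) by (metis abs_of_nonneg norm_scaleR)
    also have "\<dots> \<le> (h * K) * norm x"
      using mult_left_mono[OF K h(1)] by (simp add: mult.assoc)
    finally have "(1 - h * K) * norm x \<le> 0"
      by (simp add: algebra_simps)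
    with h(2) show ?thesis
      by (simp add: mult_le_0_iff)
  qed
  then show ?thesis
    by (simp add: invertible_left_inverse matrix_left_invertible_ker)
qed

lemma matrix_inv_right_apply:
  fixes M :: "real^'n^'n"
  assumes "invertible M"
  shows "M *v (matrix_inv M *v x) = x"
proof -
  have "M ** matrix_inv M = mat 1"
    using assms unfolding invertible_def matrix_inv_def by (rule someI2_ex) simp
  then show ?thesis
    by (simp add: matrix_vector_mul_assoc)
qed

theorem theorem4p15:
  fixes A :: "real^'n^'n" and C :: "(real^'n) set"
  assumes "proper_cone C"
    and "continuous_invariant A C"
  shows "\<exists>\<tau>>0. \<forall>\<Delta>t\<in>{0..\<tau>}.
           invertible (mat 1 - \<Delta>t *\<^sub>R A) \<and>
           (\<forall>x\<in>C. matrix_inv (mat 1 - \<Delta>t *\<^sub>R A) *v x \<in> C) \<and>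
           discrete_invariant (matrix_inv (mat 1 - \<Delta>t *\<^sub>R A)) C"
proof -
  have C: "convex_cone C" "closed C"
    using assms(1) by (auto simp: proper_cone_def)
  obtain K where K: "0 < K" "\<And>x. norm (A *v x) \<le> K * norm x"
    using bounded_linear.pos_bounded[OF matrix_vector_mul_bounded_linear[of A]]
    by (metis mult.commute)
  show ?thesis
  \<comment> \<open>The factor \<open>2\<close> keeps \<open>h * K\<close> strictly below \<open>1\<close> on the whole closed interval of step sizes.\<close>
  proof (intro exI[of _ "1 / (2 * K)"] conjI ballI)
    show "0 < 1 / (2 * K)"
      using K(1) by simp
    fix h assume "h \<in> {0..1 / (2 * K)}"
    then have h: "0 \<le> h" "h * K < 1"
      using K(1) by (auto simp: field_simps)
    let ?M = "mat 1 - h *\<^sub>R A"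
    show inv: "invertible ?M"
      by (rule identity_minus_contraction_invertible[OF K(2) h])
    show step: "matrix_inv ?M *v x \<in> C" if "x \<in> C" for x
    proof (rule implicit_step_mem_cone[OF C assms(2) K(2) h])
      show "matrix_inv ?M *v x - h *\<^sub>R (A *v (matrix_inv ?M *v x)) \<in> C"
        using matrix_inv_right_apply[OF inv, of x] that
        by (simp add: matrix_vector_mult_diff_rdistrib scaleR_matrix_vector_assoc)
    qed
    show "discrete_invariant (matrix_inv ?M) C"
      using step by (simp add: discrete_invariant_def discrete_solution_def)
  qed
qed

end
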